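(* There is an absolute constant $C>0$ such that the following holds. Let $n\ge 1$, $\varepsilon\in(0,1/2)$ and $k\ge 0$. Let $\mu$ be a probability distribution on $2^{[n]}\times 2^{[n]}$ such that, for $(A,B)\sim\mu$, the mutual information satisfies $I(A:B)\le k$. Then \[ D^\mu_\varepsilon(\mathrm{DISJ}_n)\le C\sqrt{\frac{n(k+1)}{\varepsilon}}. \]
   Context: Two-party communication: Alice holds $A\in 2^{[n]}$, Bob holds $B\in 2^{[n]}$, and they exchange bits according to a deterministic protocol; its cost is the maximum over all inputs of the number of bits exchanged. $\mathrm{DISJ}_n(A,B)=1$ iff $A\cap B=\varnothing$ (and $0$ otherwise). For a distribution $\mu$ on $2^{[n]}\times 2^{[n]}$ and $\varepsilon\in(0,1/2)$, $D^\mu_\varepsilon(\mathrm{DISJ}_n)$ is the minimum cost of a deterministic protocol (which may depend on $\mu$) whose output equals $\mathrm{DISJ}_n(A,B)$ on a set of input pairs of $\mu$-measure at least $1-\varepsilon$. For $\mu$ with marginals $\mu_A,\mu_B$, the mutual information is $I(A:B)=\sum_{a,b}\mu(a,b)\log_2\frac{\mu(a,b)}{\mu_A(a)\mu_B(b)}$. *)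

theory Defs
  imports "HOL-Probability.Probability_Mass_Function"
begin

text \<open>
  A deterministic protocol is a binary tree: at an inner node the named player announces one bit,
  a function of that player's own input and (through the position of the node in the tree) of the
  bits exchanged so far; \<^emph>\<open>True\<close> continues in the first subtree. A leaf carries the output, which is
  therefore a function of the transcript alone.
\<close>

datatype ('a, 'b, 'o) protocol =
    Output 'o
  | Alice "'a \<Rightarrow> bool" "('a, 'b, 'o) protocol" "('a, 'b, 'o) protocol"
  | Bob "'b \<Rightarrow> bool" "('a, 'b, 'o) protocol" "('a, 'b, 'o) protocol"

primrec result :: "('a, 'b, 'o) protocol \<Rightarrow> 'a \<Rightarrow> 'b \<Rightarrow> 'o" where
  "result (Output z) a b = z"
| "result (Alice f P Q) a b = (if f a then result P a b else result Q a b)"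
| "result (Bob g P Q) a b = (if g b then result P a b else result Q a b)"

primrec bits_exchanged :: "('a, 'b, 'o) protocol \<Rightarrow> 'a \<Rightarrow> 'b \<Rightarrow> nat" where
  "bits_exchanged (Output z) a b = 0"
| "bits_exchanged (Alice f P Q) a b =
     Suc (if f a then bits_exchanged P a b else bits_exchanged Q a b)"
| "bits_exchanged (Bob g P Q) a b =
     Suc (if g b then bits_exchanged P a b else bits_exchanged Q a b)"

definition cost :: "'a set \<Rightarrow> 'b set \<Rightarrow> ('a, 'b, 'o) protocol \<Rightarrow> nat" where
  "cost X Y P = Max ((\<lambda>(a, b). bits_exchanged P a b) ` (X \<times> Y))"

text \<open>
  The subsets of \<open>[n]\<close> are the elements of \<^term>\<open>Pow {1..n::nat}\<close>, and a distribution on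
  \<open>2\<^bsup>[n]\<^esup> \<times> 2\<^bsup>[n]\<^esup>\<close> is a \<^emph>\<open>pmf\<close> on pairs of sets of naturals whose support lies in
  \<^term>\<open>Pow {1..n::nat} \<times> Pow {1..n::nat}\<close>.
\<close>

definition DISJ :: "nat set \<Rightarrow> nat set \<Rightarrow> bool" where
  "DISJ A B \<longleftrightarrow> A \<inter> B = {}"

definition computes_DISJ ::
    "(nat set \<times> nat set) pmf \<Rightarrow> real \<Rightarrow> (nat set, nat set, bool) protocol \<Rightarrow> bool" where
  "computes_DISJ \<mu> \<epsilon> P \<longleftrightarrow>
     measure_pmf.prob \<mu> {(A, B). result P A B = DISJ A B} \<ge> 1 - \<epsilon>"

definition D_DISJ :: "nat \<Rightarrow> (nat set \<times> nat set) pmf \<Rightarrow> real \<Rightarrow> nat" where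
  "D_DISJ n \<mu> \<epsilon> =
     (LEAST c. \<exists>P. computes_DISJ \<mu> \<epsilon> P \<and> cost (Pow {1..n}) (Pow {1..n}) P = c)"

text \<open>Terms with \<open>\<mu>(a, b) = 0\<close> vanish, as the usual convention \<open>0 log 0 = 0\<close> requires.\<close>

definition mutual_info :: "nat \<Rightarrow> (nat set \<times> nat set) pmf \<Rightarrow> real" where
  "mutual_info n \<mu> =
     (\<Sum>(a, b) \<in> Pow {1..n} \<times> Pow {1..n}.
        pmf \<mu> (a, b) * log 2 (pmf \<mu> (a, b) / (pmf (map_pmf fst \<mu>) a * pmf (map_pmf snd \<mu>) b)))"

text \<open>
  The minimum defining \<^const>\<open>D_DISJ\<close> is over a nonempty set and hence attained: Alice can send her
  whole input, after which Bob announces the answer.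
\<close>

fun send_all :: "nat \<Rightarrow> nat set \<Rightarrow> (nat set, nat set, bool) protocol" where
  "send_all 0 S = Bob (DISJ S) (Output True) (Output False)"
| "send_all (Suc i) S =
     Alice (\<lambda>A. Suc i \<in> A) (send_all i (insert (Suc i) S)) (send_all i S)"

lemma result_send_all: "result (send_all i S) A B = DISJ (S \<union> A \<inter> {1..i}) B"
proof (induction i arbitrary: S)
  case 0
  show ?case by simp
next
  case (Suc i)
  have "S \<union> A \<inter> {1..Suc i} =
      (if Suc i \<in> A then insert (Suc i) S \<union> A \<inter> {1..i} else S \<union> A \<inter> {1..i})"
    by (auto simp: le_Suc_eq)
  with Suc show ?case by simp
qed

lemma D_DISJ_attained:
  assumes "set_pmf \<mu> \<subseteq> Pow {1..n} \<times> Pow {1..n}" and "\<epsilon> \<ge> 0"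
  shows "\<exists>P. computes_DISJ \<mu> \<epsilon> P \<and> cost (Pow {1..n}) (Pow {1..n}) P = D_DISJ n \<mu> \<epsilon>"
proof -
  have "result (send_all n {}) A B = DISJ A B" if "(A, B) \<in> set_pmf \<mu>" for A B
  proof -
    have "A \<inter> {1..n} = A" using that assms(1) by blast
    then show ?thesis by (simp add: result_send_all)
  qed
  then have "measure_pmf.prob \<mu> {(A, B). result (send_all n {}) A B = DISJ A B} = 1"
    by (subst measure_pmf.prob_eq_1) (auto simp: AE_measure_pmf_iff)
  with assms(2) have "computes_DISJ \<mu> \<epsilon> (send_all n {})"
    by (simp add: computes_DISJ_def)
  then have "\<exists>c P. computes_DISJ \<mu> \<epsilon> P \<and> cost (Pow {1..n}) (Pow {1..n}) P = c"
    by blast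
  then show ?thesis
    unfolding D_DISJ_def by (rule LeastI_ex)
qed

end

theory Submission
  imports Defs
begin

text \<open>
  Relative to the product \<open>\<nu>\<close> of the marginals, \<open>\<mu>\<close> has divergence \<open>I(A:B) \<le> k\<close>, so an event of
  \<open>\<nu>\<close>-measure \<open>2\<^bsup>-u\<^esup>\<close> has \<open>\<mu>\<close>-measure at most \<open>(k + 1) / u\<close>. It therefore suffices to solve
  disjointness under product distributions with error \<open>2\<^bsup>-u\<^esup>\<close> and \<open>O(\<surd>(n u))\<close> bits, for \<open>u\<close> about
  \<open>(k + 1) / \<epsilon>\<close>.

  Let \<open>S\<close> be the part of the universe still in play, \<open>t = u + 1\<close> and \<open>s = \<surd>(n t)\<close>. If Bob's set has
  at least \<open>s\<close> elements in \<open>S\<close>, then either Alice's set is disjoint from Bob's with conditional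
  probability below \<open>2\<^bsup>-t\<^esup>\<close> and Alice declares an intersection, or, with high probability, her set
  misses one of \<open>4\<^bsup>t\<^esup>\<close> large sets \<open>z\<close> fixed in advance; she names \<open>z\<close> with \<open>2 t\<close> bits and \<open>S\<close>
  loses at least \<open>s\<close> elements. The roles may be exchanged, so after \<open>O(n / s)\<close> such rounds both sets
  have fewer than \<open>s\<close> elements in \<open>S\<close>.

  Small sets are handled by hashing in the manner of Hastad and Wigderson: the players
  alternately announce the image of their set \<open>A\<close> under a hash function into \<open>3 |A|\<close> values, and \<open>S\<close>
  shrinks to the preimage. For disjoint sets each message thins out the other set, so both vanish
  within \<open>O(s + t)\<close> bits except with probability \<open>2\<^bsup>-t\<^esup>\<close>.
\<close>

section \<open>Error under unnormalised weights, and how protocols compose\<close>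

text \<open>\<open>w\<close> need not have total mass 1: restricting to an event sets weights to
  zero instead of renormalising, so the errors of branches simply add. Only intersection inside
  \<open>S\<close>, the universe still in play, counts.\<close>

definition weighted_error :: "'a set set \<Rightarrow> 'a set \<Rightarrow> ('a set \<Rightarrow> 'a set \<Rightarrow> real) \<Rightarrow>
    ('a set, 'a set, bool) protocol \<Rightarrow> real" where
  "weighted_error F S w P =
     (\<Sum>A\<in>F. \<Sum>B\<in>F. if result P A B = (A \<inter> B \<inter> S = {}) then 0 else w A B)"

definition solvable :: "'a set set \<Rightarrow> 'a set \<Rightarrow> nat \<Rightarrow> ('a set \<Rightarrow> 'a set \<Rightarrow> real) \<Rightarrow> real \<Rightarrow> bool" where
  "solvable F S c w e \<longleftrightarrow>
     (\<exists>P. (\<forall>A B. bits_exchanged P A B \<le> c) \<and> weighted_error F S w P \<le> e)"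

lemma solvable_mono:
  assumes "solvable F S c w e" "c \<le> c'" "e \<le> e'"
  shows "solvable F S c' w e'"
  using assms unfolding solvable_def by (meson order_trans)

text \<open>Disjointness in \<open>S\<close> and in \<open>S'\<close> has to agree only where the
  weight is nonzero. This permits shrinking the universe once the transcript has excluded the other
  pairs.\<close>

lemma solvable_cong:
  assumes "solvable F S c w e"
    and "\<And>A B. A \<in> F \<Longrightarrow> B \<in> F \<Longrightarrow> w' A B = w A B"
    and "\<And>A B. A \<in> F \<Longrightarrow> B \<in> F \<Longrightarrow> w A B \<noteq> 0 \<Longrightarrow> A \<inter> B \<inter> S' = {} \<longleftrightarrow> A \<inter> B \<inter> S = {}"
  shows "solvable F S' c w' e"
proof -
  have "weighted_error F S' w' P = weighted_error F S w P" for P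
    unfolding weighted_error_def
  proof (intro sum.cong refl)
    fix A B assume "A \<in> F" "B \<in> F"
    then show "(if result P A B = (A \<inter> B \<inter> S' = {}) then 0 else w' A B) =
        (if result P A B = (A \<inter> B \<inter> S = {}) then 0 else w A B)"
      using assms(2,3)[of A B] by (cases "w A B = 0") auto
  qed
  then show ?thesis using assms(1) unfolding solvable_def by simp
qed

primrec swap_players :: "('a, 'b, 'o) protocol \<Rightarrow> ('b, 'a, 'o) protocol" where
  "swap_players (Output z) = Output z"
| "swap_players (Alice f P Q) = Bob f (swap_players P) (swap_players Q)"
| "swap_players (Bob g P Q) = Alice g (swap_players P) (swap_players Q)"

lemma result_swap_players: "result (swap_players P) b a = result P a b"
  by (induction P) auto

lemma bits_exchanged_swap_players: "bits_exchanged (swap_players P) b a = bits_exchanged P a b"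
  by (induction P) auto

lemma solvable_swap:
  assumes "solvable F S c (\<lambda>A B. w B A) e"
  shows "solvable F S c w e"
proof -
  obtain P where P: "\<And>A B. bits_exchanged P A B \<le> c" "weighted_error F S (\<lambda>A B. w B A) P \<le> e"
    using assms unfolding solvable_def by blast
  have "weighted_error F S w (swap_players P) = weighted_error F S (\<lambda>A B. w B A) P"
    unfolding weighted_error_def result_swap_players
    by (subst sum.swap) (simp add: Int_commute)
  with P show ?thesis unfolding solvable_def
    by (intro exI[of _ "swap_players P"]) (simp add: bits_exchanged_swap_players)
qed

lemma solvable_Alice:
  assumes "solvable F S c (\<lambda>A B. if f A then w A B else 0) e1"
    and "solvable F S c (\<lambda>A B. if f A then 0 else w A B) e2"
  shows "solvable F S (Suc c) w (e1 + e2)"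
proof -
  obtain P where P: "\<And>A B. bits_exchanged P A B \<le> c"
      "weighted_error F S (\<lambda>A B. if f A then w A B else 0) P \<le> e1"
    using assms(1) unfolding solvable_def by blast
  obtain Q where Q: "\<And>A B. bits_exchanged Q A B \<le> c"
      "weighted_error F S (\<lambda>A B. if f A then 0 else w A B) Q \<le> e2"
    using assms(2) unfolding solvable_def by blast
  have "weighted_error F S w (Alice f P Q) =
      weighted_error F S (\<lambda>A B. if f A then w A B else 0) P +
      weighted_error F S (\<lambda>A B. if f A then 0 else w A B) Q"
    unfolding weighted_error_def sum.distrib[symmetric]
    by (intro sum.cong refl) auto
  with P Q show ?thesis unfolding solvable_def
    by (intro exI[of _ "Alice f P Q"]) auto
qed

lemma solvable_Bob:
  assumes "solvable F S c (\<lambda>A B. if g B then w A B else 0) e1"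
    and "solvable F S c (\<lambda>A B. if g B then 0 else w A B) e2"
  shows "solvable F S (Suc c) w (e1 + e2)"
proof -
  have "solvable F S (Suc c) (\<lambda>A B. w B A) (e1 + e2)"
    using assms by (intro solvable_Alice[where f = g]) (auto intro: solvable_swap)
  then show ?thesis by (rule solvable_swap)
qed

lemma solvable_False:
  "solvable F S 0 w (\<Sum>A\<in>F. \<Sum>B\<in>F. if A \<inter> B \<inter> S = {} then w A B else 0)"
  unfolding solvable_def weighted_error_def
  by (intro exI[of _ "Output False"]) (auto intro!: sum_mono)

lemma solvable_True:
  assumes "\<And>A B. A \<in> F \<Longrightarrow> B \<in> F \<Longrightarrow> w A B \<noteq> 0 \<Longrightarrow> A \<inter> B \<inter> S = {}"
  shows "solvable F S 0 w 0"
proof -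
  have "weighted_error F S w (Output True) = 0"
    unfolding weighted_error_def using assms by (intro sum.neutral ballI) force
  then show ?thesis unfolding solvable_def
    by (intro exI[of _ "Output True"]) simp
qed

lemma solvable_zero:
  assumes "\<And>A B. A \<in> F \<Longrightarrow> B \<in> F \<Longrightarrow> w A B = 0"
  shows "solvable F S 0 w 0"
  using assms by (intro solvable_True) auto

text \<open>Alice names \<open>f A\<close> by binary search: each bit halves the set of candidates,
  so \<open>m\<close> bits leave at most one.\<close>

lemma solvable_select:
  assumes "finite I" "card I \<le> 2 ^ m"
    and "\<And>i. i \<in> I \<Longrightarrow> solvable F S c (\<lambda>A B. if f A = i then w A B else 0) (e i)"
    and "\<And>A B. A \<in> F \<Longrightarrow> B \<in> F \<Longrightarrow> w A B \<noteq> 0 \<Longrightarrow> f A \<in> I"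
  shows "solvable F S (c + m) w (\<Sum>i\<in>I. e i)"
  using assms
proof (induction m arbitrary: I w)
  case 0
  show ?case
  proof (cases "I = {}")
    case True
    then have "solvable F S 0 w 0" using "0.prems"(4) by (intro solvable_zero) auto
    then show ?thesis using True by (auto intro: solvable_mono)
  next
    case False
    then obtain i where i: "I = {i}"
      using "0.prems"(1,2) by (metis card_0_eq card_1_singletonE le_Suc_eq le_zero_eq power_0 One_nat_def)
    have "solvable F S c w (e i)"
      by (rule solvable_cong[OF "0.prems"(3)[of i]]) (use i "0.prems"(4) in auto)
    then show ?thesis using i by simp
  qed
next
  case (Suc m)
  obtain J where J: "J \<subseteq> I" "card J \<le> 2 ^ m" "card (I - J) \<le> 2 ^ m"
  proof (cases "card I \<le> 2 ^ m")
    case True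
    then show ?thesis using that[of I] by simp
  next
    case False
    then obtain J where J: "J \<subseteq> I" "card J = 2 ^ m" "finite J"
      using obtain_subset_with_card_n[of "2 ^ m" I] by (metis nat_le_linear)
    then have "card (I - J) \<le> 2 ^ m"
      using Suc.prems(2) by (simp add: card_Diff_subset)
    with J that show ?thesis by simp
  qed
  have fin: "finite J" "finite (I - J)" using J Suc.prems(1) by (auto intro: finite_subset)
  have "solvable F S (c + m) (\<lambda>A B. if f A \<in> J then w A B else 0) (sum e J)"
  proof (rule Suc.IH[OF fin(1) J(2)])
    fix i assume "i \<in> J"
    then show "solvable F S c (\<lambda>A B. if f A = i then if f A \<in> J then w A B else 0 else 0) (e i)"
      using J by (intro solvable_cong[OF Suc.prems(3)[of i]]) auto
  qed (auto split: if_splits)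
  moreover have "solvable F S (c + m) (\<lambda>A B. if f A \<in> J then 0 else w A B) (sum e (I - J))"
  proof (rule Suc.IH[OF fin(2) J(3)])
    fix i assume "i \<in> I - J"
    then show "solvable F S c (\<lambda>A B. if f A = i then if f A \<in> J then 0 else w A B else 0) (e i)"
      by (intro solvable_cong[OF Suc.prems(3)[of i]]) auto
  qed (use Suc.prems(4) in \<open>auto split: if_splits\<close>)
  ultimately have "solvable F S (Suc (c + m)) w (sum e J + sum e (I - J))"
    by (rule solvable_Alice)
  also have "sum e J + sum e (I - J) = sum e I"
    using J(1) Suc.prems(1) by (metis add.commute sum.subset_diff)
  finally show ?case by simp
qed

text \<open>Alice announces \<open>f A\<close> in unary, one bit per excluded value, so the value
  \<open>i\<close> costs \<open>i + 1\<close> bits and small values are cheap. After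
  \<open>D\<close> negative answers only \<open>f A \<ge> D\<close> is possible.\<close>

lemma solvable_unary:
  assumes "\<And>i. i < D \<Longrightarrow> solvable F S (c i) (\<lambda>A B. if f A = i then w A B else 0) (e i)"
    and "\<And>i. i < D \<Longrightarrow> Suc i + c i \<le> C"
    and "solvable F S c' (\<lambda>A B. if f A \<ge> D then w A B else 0) e'"
    and "D + c' \<le> C"
  shows "solvable F S C w ((\<Sum>i<D. e i) + e')"
  using assms
proof (induction D arbitrary: f w c e C)
  case 0
  then show ?case by (auto intro: solvable_mono)
next
  case (Suc D)
  obtain C0 where C0: "C = Suc C0" using Suc.prems(4) by (cases C) auto
  have 1: "solvable F S C0 (\<lambda>A B. if f A = 0 then w A B else 0) (e 0)"
    using Suc.prems(1)[of 0] Suc.prems(2)[of 0] C0 by (auto intro: solvable_mono)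
  have 2: "solvable F S C0 (\<lambda>A B. if f A = 0 then 0 else w A B) ((\<Sum>i<D. e (Suc i)) + e')"
  \<comment> \<open>Once the value 0 is excluded, the others shift down by one. The truncated
    subtraction also sends 0 to 0, but those pairs now have weight 0.\<close>
  proof (rule Suc.IH[where f = "\<lambda>A. f A - 1" and c = "\<lambda>i. c (Suc i)"])
    fix i assume i: "i < D"
    show "solvable F S (c (Suc i)) (\<lambda>A B. if f A - 1 = i then if f A = 0 then 0 else w A B else 0) (e (Suc i))"
      by (rule solvable_cong[OF Suc.prems(1)[of "Suc i"]]) (use i in auto)
    show "Suc i + c (Suc i) \<le> C0" using Suc.prems(2)[of "Suc i"] i C0 by simp
  next
    show "solvable F S c' (\<lambda>A B. if D \<le> f A - 1 then if f A = 0 then 0 else w A B else 0) e'"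
      by (rule solvable_cong[OF Suc.prems(3)]) auto
    show "D + c' \<le> C0" using Suc.prems(4) C0 by simp
  qed
  show ?case unfolding C0 sum.lessThan_Suc_shift add.assoc
    by (rule solvable_Alice[OF 1 2])
qed

section \<open>The hashing protocol for small sets\<close>

text \<open>For a uniformly random \<open>h\<close>, the values on \<open>B\<close> are independent
  of those on \<open>A\<close>, as the sets are disjoint. A point of \<open>B\<close> collides with
  probability at most 1/3, so it contributes an expected factor of at most
  \<open>1 + 3 / 3 = 2\<close>. The sum is this expectation times the number of functions.\<close>

lemma sum_hash_collisions:
  fixes m :: nat
  assumes "finite B" "finite S" "B \<subseteq> S" "A \<subseteq> S" "A \<inter> B = {}" "3 * card A \<le> m"
  shows "(\<Sum>h\<in>S \<rightarrow>\<^sub>E {..<m}. 4 ^ card {x\<in>B. h x \<in> h ` A} :: real) \<le> 2 ^ card B * m ^ card S"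
  using assms
proof (induction B arbitrary: S rule: finite_induct)
  case empty
  then show ?case by (simp add: card_PiE)
next
  case (insert b B)
  define S0 where "S0 = S - {b}"
  have S: "S = insert b S0" "b \<notin> S0" "finite S0" using insert.prems by (auto simp: S0_def)
  have sub: "B \<subseteq> S0" "A \<subseteq> S0" using insert.prems insert.hyps by (auto simp: S0_def)
  have "finite A" using sub S(3) finite_subset by blast
  let ?N = "\<lambda>h. card {x\<in>B. h x \<in> h ` A}"
  have inj: "inj_on (\<lambda>(y, g). g(b := y)) ({..<m} \<times> (S0 \<rightarrow>\<^sub>E {..<m}))"
    using inj_combinator[OF S(2), of "\<lambda>_. {..<m}"] by simp
  have step: "4 ^ card {x\<in>insert b B. (g(b := y)) x \<in> (g(b := y)) ` A} =
      (if y \<in> g ` A then 4 else 1 :: real) * 4 ^ ?N g" for g y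
  proof -
    have "b \<notin> A" using insert.prems by auto
    then have img: "(g(b := y)) ` A = g ` A" by (auto simp: image_def)
    have "{x\<in>insert b B. (g(b := y)) x \<in> g ` A} =
        (if y \<in> g ` A then insert b {x\<in>B. g x \<in> g ` A} else {x\<in>B. g x \<in> g ` A})"
      using insert.hyps by auto
    then show ?thesis unfolding img using insert.hyps by simp
  qed
  have le: "(\<Sum>y<m. if y \<in> g ` A then 4 else 1 :: real) \<le> 2 * m" for g :: "'a \<Rightarrow> nat"
  proof -
    have "(\<Sum>y<m. if y \<in> g ` A then 4 else 1 :: real) = (\<Sum>y<m. 1 + (if y \<in> g ` A then 3 else 0))"
      by (intro sum.cong) auto
    also have "\<dots> = m + 3 * card ({..<m} \<inter> g ` A)"
      by (simp add: sum.distrib sum.If_cases Int_def)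
    also have "card ({..<m} \<inter> g ` A) \<le> card (g ` A)"
      using \<open>finite A\<close> by (intro card_mono) auto
    also have "card (g ` A) \<le> card A" using \<open>finite A\<close> by (rule card_image_le)
    finally show ?thesis using insert.prems(5) by simp
  qed
  have "(\<Sum>h\<in>S \<rightarrow>\<^sub>E {..<m}. 4 ^ card {x\<in>insert b B. h x \<in> h ` A} :: real) =
      (\<Sum>(y, g)\<in>{..<m} \<times> (S0 \<rightarrow>\<^sub>E {..<m}). (if y \<in> g ` A then 4 else 1) * 4 ^ ?N g)"
    unfolding S(1) PiE_insert_eq
    by (subst sum.reindex[OF inj]) (simp only: o_def case_prod_unfold step)
  also have "\<dots> = (\<Sum>g\<in>S0 \<rightarrow>\<^sub>E {..<m}. (\<Sum>y<m. if y \<in> g ` A then 4 else 1) * 4 ^ ?N g)"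
    unfolding sum.cartesian_product[symmetric] by (subst sum.swap) (simp add: sum_distrib_right)
  also have "\<dots> \<le> (\<Sum>g\<in>S0 \<rightarrow>\<^sub>E {..<m}. real (2 * m) * 4 ^ ?N g)"
    by (intro sum_mono mult_right_mono le) auto
  also have "\<dots> = real (2 * m) * (\<Sum>g\<in>S0 \<rightarrow>\<^sub>E {..<m}. 4 ^ ?N g)"
    by (simp add: sum_distrib_left)
  also have "\<dots> \<le> real (2 * m) * (2 ^ card B * m ^ card S0)"
    using insert.IH[OF S(3) sub] insert.prems by (intro mult_left_mono) auto
  also have "\<dots> = 2 ^ card (insert b B) * m ^ card S"
    using insert.hyps S by simp
  finally show ?case .
qed


lemma exists_le_average:
  fixes g :: "'a \<Rightarrow> real" and c :: real
  assumes "finite H" "H \<noteq> {}" "(\<Sum>h\<in>H. g h) \<le> card H * c"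
  shows "\<exists>h\<in>H. g h \<le> c"
proof (rule ccontr)
  assume "\<not> ?thesis"
  then have "(\<Sum>h\<in>H. c) < (\<Sum>h\<in>H. g h)"
    using assms by (intro sum_strict_mono) (auto simp: not_le)
  then show False using assms(3) by simp
qed

text \<open>One message, sent when Alice's set has exactly \<open>a\<close> elements in
  \<open>S\<close>. She sends its hash image as a subset of \<open>3 * a\<close> values;
  \<open>S\<close> shrinks to the preimage, which keeps all of her set but only the colliding points
  of Bob's. By averaging, one fixed \<open>h\<close> is good for the whole weighted sum.
  \<open>IH\<close> is applied with the players exchanged, so that Bob's remaining set carries the
  base 4.\<close>

lemma solvable_hash:
  fixes w :: "'a set \<Rightarrow> 'a set \<Rightarrow> real"
  assumes "finite S" "\<And>A B. w A B \<ge> 0" "a \<ge> 1"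
    and card: "\<And>A B. A \<in> F \<Longrightarrow> B \<in> F \<Longrightarrow> w A B \<noteq> 0 \<Longrightarrow> card (A \<inter> S) = a"
    and IH: "\<And>S' (w' :: 'a set \<Rightarrow> 'a set \<Rightarrow> real). finite S' \<Longrightarrow> (\<And>A B. w' A B \<ge> 0) \<Longrightarrow>
      solvable F S' c w' ((\<Sum>A\<in>F. \<Sum>B\<in>F. if A \<inter> B \<inter> S' = {}
          then w' A B * 4 ^ card (A \<inter> S') * 2 ^ card (B \<inter> S') else 0) / D)"
    and "D > 0"
  shows "solvable F S (c + 3 * a) w ((\<Sum>A\<in>F. \<Sum>B\<in>F. if A \<inter> B \<inter> S = {}
          then w A B * 2 ^ a * 2 ^ card (B \<inter> S) else 0) / D)"
proof -
  let ?m = "3 * a"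
  let ?H = "S \<rightarrow>\<^sub>E {..<?m}"
  let ?N = "\<lambda>h A B. card {x\<in>B \<inter> S. h x \<in> h ` (A \<inter> S)}"
  define G where "G h = (\<Sum>A\<in>F. \<Sum>B\<in>F. if A \<inter> B \<inter> S = {} then w A B * 4 ^ ?N h A B else 0)"
    for h :: "'a \<Rightarrow> nat"
  let ?W = "\<Sum>A\<in>F. \<Sum>B\<in>F. if A \<inter> B \<inter> S = {} then w A B * 2 ^ card (B \<inter> S) else 0"
  have cH: "card ?H = ?m ^ card S" using assms(1) by (simp add: card_PiE)
  have fH: "finite ?H" using assms(1) by (intro finite_PiE) auto
  have "card ?H \<noteq> 0" using cH assms(3) by simp
  then have nH: "?H \<noteq> {}" by (metis card.empty)
  have "(\<Sum>h\<in>?H. G h) = (\<Sum>A\<in>F. \<Sum>B\<in>F. \<Sum>h\<in>?H.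
      if A \<inter> B \<inter> S = {} then w A B * 4 ^ ?N h A B else 0)"
    unfolding G_def by (subst sum.swap, rule sum.cong[OF refl], rule sum.swap)
  also have "\<dots> \<le> (\<Sum>A\<in>F. \<Sum>B\<in>F. card ?H *
      (if A \<inter> B \<inter> S = {} then w A B * 2 ^ card (B \<inter> S) else 0))"
  proof (intro sum_mono)
    fix A B assume AB: "A \<in> F" "B \<in> F"
    show "(\<Sum>h\<in>?H. if A \<inter> B \<inter> S = {} then w A B * 4 ^ ?N h A B else 0) \<le>
        card ?H * (if A \<inter> B \<inter> S = {} then w A B * 2 ^ card (B \<inter> S) else 0)"
    proof (cases "A \<inter> B \<inter> S = {} \<and> w A B \<noteq> 0")
      case True
      have "(\<Sum>h\<in>?H. 4 ^ ?N h A B :: real) \<le> 2 ^ card (B \<inter> S) * ?m ^ card S"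
        using True card[OF AB] assms(1) by (intro sum_hash_collisions) auto
      then have "w A B * (\<Sum>h\<in>?H. 4 ^ ?N h A B :: real) \<le> w A B * (2 ^ card (B \<inter> S) * ?m ^ card S)"
        by (intro mult_left_mono assms(2))
      then show ?thesis using True unfolding cH by (simp add: sum_distrib_left mult_ac)
    qed auto
  qed
  also have "\<dots> = card ?H * ?W" by (simp add: sum_distrib_left)
  finally obtain h where h: "h \<in> ?H" "G h \<le> ?W"
    using exists_le_average[OF fH nH] by blast
  define T where "T M = {x\<in>S. h x \<in> M}" for M
  define f where "f A = h ` (A \<inter> S)" for A
  define wM where "wM M A B = (if f A = M then w A B else 0)" for M A B
  define e where "e M = (\<Sum>A\<in>F. \<Sum>B\<in>F. if A \<inter> B \<inter> S = {}
      then wM M A B * 4 ^ ?N h A B * 2 ^ a else 0) / D" for M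
  have "solvable F S c (wM M) (e M)" for M
  proof -
    have sub: "A \<inter> T M = A \<inter> S" if "wM M A B \<noteq> 0" for A B
      using that by (auto simp: wM_def f_def T_def split: if_splits)
    have iff: "A \<inter> B \<inter> S = {} \<longleftrightarrow> A \<inter> B \<inter> T M = {}" if "wM M A B \<noteq> 0" for A B
      using sub[OF that] by blast
    have "solvable F (T M) c (\<lambda>B A. wM M A B) ((\<Sum>B\<in>F. \<Sum>A\<in>F. if B \<inter> A \<inter> T M = {}
          then wM M A B * 4 ^ card (B \<inter> T M) * 2 ^ card (A \<inter> T M) else 0) / D)"
      using assms(1,2) by (intro IH) (auto simp: T_def wM_def)
    also have "(\<Sum>B\<in>F. \<Sum>A\<in>F. if B \<inter> A \<inter> T M = {}
          then wM M A B * 4 ^ card (B \<inter> T M) * 2 ^ card (A \<inter> T M) else 0) / D = e M"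
      unfolding e_def
    proof (subst sum.swap, intro arg_cong[where f = "\<lambda>x. x / D"] sum.cong refl)
      fix A B assume AB: "A \<in> F" "B \<in> F"
      show "(if B \<inter> A \<inter> T M = {} then wM M A B * 4 ^ card (B \<inter> T M) * 2 ^ card (A \<inter> T M) else 0) =
        (if A \<inter> B \<inter> S = {} then wM M A B * 4 ^ ?N h A B * 2 ^ a else 0)"
      proof (cases "wM M A B = 0")
        case False
        then have "f A = M" "w A B \<noteq> 0" by (auto simp: wM_def split: if_splits)
        then have "B \<inter> T M = {x\<in>B \<inter> S. h x \<in> h ` (A \<inter> S)}" by (auto simp: T_def f_def)
        moreover have "card (A \<inter> T M) = a" using sub[OF False] card[OF AB \<open>w A B \<noteq> 0\<close>] by simp
        ultimately show ?thesis using iff[OF False] by (simp add: Int_commute)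
      qed simp
    qed
    finally have "solvable F (T M) c (wM M) (e M)" by (rule solvable_swap)
    then show ?thesis by (rule solvable_cong) (use iff in auto)
  qed
  then have "solvable F S (c + ?m) w (\<Sum>M\<in>Pow {..<?m}. e M)"
    unfolding wM_def
  proof (intro solvable_select[where f = f])
    fix A show "f A \<in> Pow {..<?m}" using h(1) by (auto simp: f_def)
  qed (auto simp: card_Pow)
  moreover have "(\<Sum>M\<in>Pow {..<?m}. e M) \<le> (\<Sum>A\<in>F. \<Sum>B\<in>F. if A \<inter> B \<inter> S = {}
          then w A B * 2 ^ a * 2 ^ card (B \<inter> S) else 0) / D"
  proof -
    have "(\<Sum>M\<in>Pow {..<?m}. e M) = (\<Sum>A\<in>F. \<Sum>B\<in>F. \<Sum>M\<in>Pow {..<?m}. if A \<inter> B \<inter> S = {}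
      then wM M A B * 4 ^ ?N h A B * 2 ^ a else 0) / D"
      unfolding e_def sum_divide_distrib[symmetric]
      by (subst sum.swap, rule arg_cong[where f = "\<lambda>x. x / D"], rule sum.cong[OF refl], rule sum.swap)
    also have "\<dots> = (\<Sum>A\<in>F. \<Sum>B\<in>F. 2 ^ a * (if A \<inter> B \<inter> S = {} then w A B * 4 ^ ?N h A B else 0)) / D"
    proof (intro arg_cong[where f = "\<lambda>x. x / D"] sum.cong refl)
      fix A B
      have "f A \<in> Pow {..<?m}" using h(1) by (auto simp: f_def)
      then have "(\<Sum>M\<in>Pow {..<?m}. wM M A B) = w A B" unfolding wM_def by (subst sum.delta') auto
      then show "(\<Sum>M\<in>Pow {..<?m}. if A \<inter> B \<inter> S = {} then wM M A B * 4 ^ ?N h A B * 2 ^ a else 0) =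
        2 ^ a * (if A \<inter> B \<inter> S = {} then w A B * 4 ^ ?N h A B else 0)"
        by (simp add: sum_distrib_right[symmetric])
    qed
    also have "\<dots> = 2 ^ a * G h / D" unfolding G_def by (simp add: sum_distrib_left)
    also have "\<dots> \<le> 2 ^ a * ?W / D" using h(2) assms(6) by (intro divide_right_mono mult_left_mono) auto
    also have "2 ^ a * ?W = (\<Sum>A\<in>F. \<Sum>B\<in>F. if A \<inter> B \<inter> S = {}
          then w A B * 2 ^ a * 2 ^ card (B \<inter> S) else 0)"
      unfolding sum_distrib_left by (intro sum.cong refl) auto
    finally show ?thesis .
  qed
  ultimately show ?thesis by (auto intro: solvable_mono)
qed

text \<open>
  The weights \<open>4\<^bsup>|A|\<^esup> 2\<^bsup>|B|\<^esup>\<close> form the potential of the hashing protocol: a message by Alice costs at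
  most \<open>6 |A|\<close> bits, and it turns the average of \<open>4\<^bsup>|B|\<^esup>\<close> into at most \<open>2\<^bsup>|B|\<^esup>\<close>, which pays for the
  exchange of roles. Intersecting pairs do not occur in the bound, so on them the protocol is correct.
\<close>

lemma solvable_sparse:
  fixes w :: "'a set \<Rightarrow> 'a set \<Rightarrow> real"
  assumes "finite F" "finite S" "\<And>A B. w A B \<ge> 0"
  shows "solvable F S (6 * d) w ((\<Sum>A\<in>F. \<Sum>B\<in>F. if A \<inter> B \<inter> S = {}
          then w A B * 4 ^ card (A \<inter> S) * 2 ^ card (B \<inter> S) else 0) / 2 ^ d)"
  using assms(2,3)
proof (induction d arbitrary: S w rule: less_induct)
  case (less d)
  let ?g = "\<lambda>(w :: 'a set \<Rightarrow> 'a set \<Rightarrow> real) A B. if A \<inter> B \<inter> S = {} then w A B * 4 ^ card (A \<inter> S) * 2 ^ card (B \<inter> S) else 0"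
  let ?f = "\<lambda>A. card (A \<inter> S)"
  define wi where "wi i A B = (if ?f A = i then w A B else 0)" for i A B
  define wo where "wo A B = (if ?f A \<ge> Suc d then w A B else 0)" for A B
  define e where "e w = (\<Sum>A\<in>F. \<Sum>B\<in>F. ?g w A B) / 2 ^ d" for w
  have nn: "wi i A B \<ge> 0" "wo A B \<ge> 0" for i A B using less.prems by (auto simp: wi_def wo_def)
  show ?case
  proof (cases "d = 0")
    case True
    have "solvable F S 0 w (\<Sum>A\<in>F. \<Sum>B\<in>F. if A \<inter> B \<inter> S = {} then w A B else 0)"
      by (rule solvable_False)
    moreover have "(\<Sum>A\<in>F. \<Sum>B\<in>F. if A \<inter> B \<inter> S = {} then w A B else 0) \<le> (\<Sum>A\<in>F. \<Sum>B\<in>F. ?g w A B)"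
    proof (intro sum_mono)
      fix A B
      have "w A B * 1 \<le> w A B * (4 ^ card (A \<inter> S) * 2 ^ card (B \<inter> S))"
        using less.prems by (intro mult_left_mono mult_ge1_I) (auto simp: one_le_power)
      then show "(if A \<inter> B \<inter> S = {} then w A B else 0) \<le> ?g w A B" by (simp add: mult.assoc)
    qed
    ultimately show ?thesis using True by (auto intro: solvable_mono)
  next
    case False
    \<comment> \<open>Alice announces the size of her set in unary up to \<open>d\<close>. Larger
      sizes are given up with the answer \<open>False\<close>; the potential is at least
      \<open>2 ^ d\<close> there and pays for the error.\<close>
    have "solvable F S (6 * d) w ((\<Sum>i<Suc d. e (wi i)) + e wo)"
    proof (rule solvable_unary[where f = ?f and c = "\<lambda>i. 6 * d - Suc i" and c' = 0])
      fix i assume i: "i < Suc d"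
      show "Suc i + (6 * d - Suc i) \<le> 6 * d" using i False by simp
      show "solvable F S (6 * d - Suc i) (\<lambda>A B. if ?f A = i then w A B else 0) (e (wi i))"
        unfolding wi_def[symmetric]
      proof (cases "i = 0")
        case True
        have "solvable F S 0 (wi i) 0"
          using True less.prems by (intro solvable_True) (auto simp: wi_def split: if_splits)
        moreover have "0 \<le> e (wi i)" unfolding e_def using nn
          by (intro divide_nonneg_nonneg sum_nonneg) auto
        ultimately show "solvable F S (6 * d - Suc i) (wi i) (e (wi i))" by (auto intro: solvable_mono)
      next
        case i0: False
        \<comment> \<open>The budget drops from \<open>d\<close> to \<open>d - i\<close>. Size and
          image cost \<open>(i + 1) + 3 * i \<le> 6 * i\<close> bits as \<open>i \<ge> 1\<close>,
          and \<open>4 ^ i / 2 ^ d = 2 ^ i / 2 ^ (d - i)\<close> matches the errors.\<close>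
        have "solvable F S (6 * (d - i) + 3 * i) (wi i) ((\<Sum>A\<in>F. \<Sum>B\<in>F. if A \<inter> B \<inter> S = {}
          then wi i A B * 2 ^ i * 2 ^ card (B \<inter> S) else 0) / 2 ^ (d - i))"
          using i0 i less.prems nn
          by (intro solvable_hash less.IH) (auto simp: wi_def split: if_splits)
        also have "(\<Sum>A\<in>F. \<Sum>B\<in>F. if A \<inter> B \<inter> S = {}
          then wi i A B * 2 ^ i * 2 ^ card (B \<inter> S) else 0) / 2 ^ (d - i) = e (wi i)"
        proof -
          have "(2::real) ^ d = 2 ^ (d - i) * 2 ^ i" using i by (simp flip: power_add)
          moreover have "(4::real) ^ i = 2 ^ i * 2 ^ i" by (simp flip: power_mult_distrib)
          ultimately show ?thesis unfolding e_def sum_divide_distrib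
            by (intro sum.cong refl) (auto simp: wi_def)
        qed
        finally show "solvable F S (6 * d - Suc i) (wi i) (e (wi i))"
          using i i0 by (auto intro: solvable_mono)
      qed
    next
      show "Suc d + 0 \<le> 6 * d" using False by simp
      have "solvable F S 0 wo (\<Sum>A\<in>F. \<Sum>B\<in>F. if A \<inter> B \<inter> S = {} then wo A B else 0)"
        by (rule solvable_False)
      moreover have "(\<Sum>A\<in>F. \<Sum>B\<in>F. if A \<inter> B \<inter> S = {} then wo A B else 0) \<le> e wo"
        unfolding e_def sum_divide_distrib
      proof (intro sum_mono)
        fix A B
        show "(if A \<inter> B \<inter> S = {} then wo A B else 0) \<le> ?g wo A B / 2 ^ d"
        proof (cases "?f A \<ge> Suc d")
          case True
          have "(2::real) ^ d \<le> 2 ^ ?f A" using True by (intro power_increasing) auto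
          also have "\<dots> \<le> 4 ^ ?f A" by (intro power_mono) auto
          also have "\<dots> \<le> 4 ^ ?f A * 2 ^ card (B \<inter> S)" by (simp add: one_le_power)
          finally have "wo A B * 2 ^ d \<le> wo A B * (4 ^ ?f A * 2 ^ card (B \<inter> S))"
            using nn by (intro mult_left_mono)
          then show ?thesis by (simp add: field_simps)
        qed (simp add: wo_def)
      qed
      ultimately show "solvable F S 0 (\<lambda>A B. if Suc d \<le> ?f A then w A B else 0) (e wo)"
        unfolding wo_def[symmetric] by (auto intro: solvable_mono)
    qed
    also have "(\<Sum>i<Suc d. e (wi i)) + e wo = e w"
    proof -
      have "(\<Sum>i<Suc d. e (wi i)) + e wo =
          ((\<Sum>A\<in>F. \<Sum>B\<in>F. (\<Sum>i<Suc d. ?g (wi i) A B)) + (\<Sum>A\<in>F. \<Sum>B\<in>F. ?g wo A B)) / 2 ^ d"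
        unfolding e_def sum_divide_distrib[symmetric] add_divide_distrib[symmetric]
        by (subst sum.swap, rule arg_cong[where f = "\<lambda>x. (x + _) / _"], rule sum.cong[OF refl],
            rule sum.swap)
      also have "\<dots> = e w"
        unfolding e_def sum.distrib[symmetric]
      proof (intro arg_cong[where f = "\<lambda>x. x / 2 ^ d"] sum.cong refl)
        fix A B
        have "(\<Sum>i<Suc d. ?g (wi i) A B) = (\<Sum>i<Suc d. if ?f A = i then ?g w A B else 0)"
          by (intro sum.cong refl) (auto simp: wi_def)
        also have "\<dots> = (if ?f A < Suc d then ?g w A B else 0)" by (subst sum.delta') auto
        finally show "(\<Sum>i<Suc d. ?g (wi i) A B) + ?g wo A B = ?g w A B" by (auto simp: wo_def)
      qed
      finally show ?thesis .
    qed
    finally show ?thesis unfolding e_def .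
  qed
qed


section \<open>Product weights: shrinking the universe by large sets\<close>

text \<open>Double counting: every \<open>x\<close> is related to a \<open>\<delta>\<close> fraction
  of the \<open>q\<close>-mass, so some \<open>y\<close> is related to a \<open>\<delta>\<close>
  fraction of the \<open>p\<close>-mass still uncovered. Adding such a \<open>y\<close> at each step
  removes this fraction.\<close>

lemma greedy_cover:
  fixes p :: "'x \<Rightarrow> real" and q :: "'y \<Rightarrow> real"
  assumes "finite F" "finite X" "\<And>x. p x \<ge> 0" "\<And>y. q y \<ge> 0" "sum q F > 0"
    and deg: "\<And>x. x \<in> X \<Longrightarrow> \<delta> * sum q F \<le> sum q {y\<in>F. R x y}"
    and "\<delta> \<le> 1"
  shows "\<exists>Z\<subseteq>{y\<in>F. q y \<noteq> 0}. card Z \<le> N \<and>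
    sum p {x\<in>X. \<forall>z\<in>Z. \<not> R x z} \<le> (1 - \<delta>) ^ N * sum p X"
proof (induction N)
  case 0
  show ?case by (intro exI[of _ "{}"]) simp
next
  case (Suc N)
  then obtain Z where Z: "Z \<subseteq> {y\<in>F. q y \<noteq> 0}" "card Z \<le> N"
      "sum p {x\<in>X. \<forall>z\<in>Z. \<not> R x z} \<le> (1 - \<delta>) ^ N * sum p X" by blast
  define U where "U = {x\<in>X. \<forall>z\<in>Z. \<not> R x z}"
  have U: "finite U" "U \<subseteq> X" using assms(2) by (auto simp: U_def)
  have "\<exists>y\<in>F. q y \<noteq> 0 \<and> \<delta> * sum p U \<le> sum p {x\<in>U. R x y}"
  proof (rule ccontr)
    assume neg: "\<not> ?thesis"
    obtain y0 where y0: "y0 \<in> F" "q y0 \<noteq> 0" using assms(5) by (metis less_irrefl sum.neutral)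
    have "\<delta> * sum p U * sum q F = (\<Sum>x\<in>U. p x * (\<delta> * sum q F))"
      by (simp add: sum_distrib_right sum_distrib_left mult_ac)
    also have "\<dots> \<le> (\<Sum>x\<in>U. p x * sum q {y\<in>F. R x y})"
      using U deg assms(3) by (intro sum_mono mult_left_mono) auto
    also have "\<dots> = (\<Sum>x\<in>U. \<Sum>y\<in>F. if R x y then p x * q y else 0)"
      using assms(1) by (simp add: sum.inter_filter sum_distrib_left if_distrib cong: if_cong)
    also have "\<dots> = (\<Sum>y\<in>F. q y * sum p {x\<in>U. R x y})"
      using U by (subst sum.swap)
        (simp add: sum.inter_filter sum_distrib_left if_distrib mult.commute cong: if_cong)
    also have "\<dots> < (\<Sum>y\<in>F. q y * (\<delta> * sum p U))"
    proof (rule sum_strict_mono_ex1[OF assms(1)])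
      show "\<forall>y\<in>F. q y * sum p {x\<in>U. R x y} \<le> q y * (\<delta> * sum p U)"
      proof
        fix y assume "y \<in> F"
        then show "q y * sum p {x\<in>U. R x y} \<le> q y * (\<delta> * sum p U)"
          using neg assms(4)[of y] by (cases "q y = 0") (auto simp: not_le)
      qed
      have "q y0 > 0" using y0 assms(4)[of y0] by simp
      then have "q y0 * sum p {x\<in>U. R x y0} < q y0 * (\<delta> * sum p U)"
        using y0 neg by (auto simp: not_le)
      then show "\<exists>y\<in>F. q y * sum p {x\<in>U. R x y} < q y * (\<delta> * sum p U)" using y0 by blast
    qed
    also have "\<dots> = \<delta> * sum p U * sum q F"
      unfolding sum_distrib_right[symmetric] by (simp add: mult_ac)
    finally show False by simp
  qed
  then obtain y where y: "y \<in> F" "q y \<noteq> 0" "\<delta> * sum p U \<le> sum p {x\<in>U. R x y}" by blast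
  have "finite Z" using Z(1) assms(1) by (auto intro: finite_subset)
  then have "card (insert y Z) \<le> Suc N" using Z(2) by (simp add: card_insert_if)
  moreover have "sum p {x\<in>X. \<forall>z\<in>insert y Z. \<not> R x z} = sum p U - sum p {x\<in>U. R x y}"
  proof -
    have "{x\<in>X. \<forall>z\<in>insert y Z. \<not> R x z} = U - {x\<in>U. R x y}" by (auto simp: U_def)
    then show ?thesis using U by (simp add: sum_diff)
  qed
  moreover have "sum p U - sum p {x\<in>U. R x y} \<le> (1 - \<delta>) * sum p U"
    using y(3) by (simp add: algebra_simps)
  moreover have "(1 - \<delta>) * sum p U \<le> (1 - \<delta>) * ((1 - \<delta>) ^ N * sum p X)"
    using Z(3) assms(7) by (intro mult_left_mono) (auto simp: U_def)
  ultimately show ?case using Z(1) y by (intro exI[of _ "insert y Z"]) (auto simp: mult.assoc)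
qed

text \<open>By \<open>1 - x \<le> exp (- x)\<close> the power is at most
  \<open>exp (- (2 ^ t))\<close>, and \<open>t < 2 ^ t\<close>. This bounds what
  \<open>4 ^ t\<close> greedy choices leave uncovered.\<close>

lemma one_minus_inverse_power_le:
  "(1 - 1 / 2 ^ t) ^ 4 ^ t \<le> 1 / (2 * 2 ^ t :: real)"
proof -
  have "(1 - 1 / 2 ^ t :: real) ^ 4 ^ t \<le> exp (- (1 / 2 ^ t)) ^ 4 ^ t"
    using exp_ge_add_one_self[of "- (1 / 2 ^ t)"] by (intro power_mono) auto
  also have "\<dots> = exp (- (2 ^ t))"
    by (simp add: exp_of_nat_mult[symmetric] field_simps power_mult_distrib[symmetric])
  also have "\<dots> = 1 / exp 1 ^ 2 ^ t" by (simp add: exp_of_nat_mult[symmetric] exp_minus field_simps)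
  also have "\<dots> \<le> 1 / 2 ^ 2 ^ t"
    using exp_ge_add_one_self[of 1] by (intro divide_left_mono power_mono) auto
  also have "\<dots> \<le> 1 / 2 ^ Suc t"
    by (intro divide_left_mono power_increasing) (auto simp: Suc_le_eq less_exp)
  finally show ?thesis by simp
qed

text \<open>
  The factor \<open>K (4\<^bsup>t\<^esup>)\<^bsup>r\<^esup>\<close> bounds the probability of running out of rounds while \<open>r\<close> reductions of the
  universe are still needed. A round divides it by \<open>2\<^bsup>t\<^esup>\<close>: a successful one lowers \<open>r\<close>, and an
  unsuccessful one has probability at most \<open>2\<^bsup>-t-1\<^esup>\<close>. Each input pair meets at most one quitting
  player, so the error \<open>2\<^bsup>-t\<^esup>\<close> of quitting is not multiplied by the number of rounds.
\<close>

lemma solvable_product_round: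
  fixes p q :: "'a set \<Rightarrow> real"
  assumes "finite F" "finite S" "\<And>A. p A \<ge> 0" "\<And>B. q B \<ge> 0" "s \<ge> 1" "t \<ge> 1" "K \<ge> 0"
    and big: "\<And>B. B \<in> F \<Longrightarrow> q B \<noteq> 0 \<Longrightarrow> s \<le> card (B \<inter> S)"
    and IH: "\<And>S' (p' :: 'a set \<Rightarrow> real) q'. finite S' \<Longrightarrow> (\<And>A. p' A \<ge> 0) \<Longrightarrow> (\<And>B. q' B \<ge> 0) \<Longrightarrow>
      solvable F S' c (\<lambda>A B. p' A * q' B)
        (sum p' F * sum q' F * (1 / 2 ^ t + K * (4 ^ t) ^ (card S' div s)))"
  shows "solvable F S (c + 2 * t + 2) (\<lambda>A B. p A * q B)
        (sum p F * sum q F * (1 / 2 ^ t + K * (4 ^ t) ^ (card S div s) / 2 ^ t))"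
proof (cases "sum q F = 0")
  case True
  then have "q B = 0" if "B \<in> F" for B
    using that assms(1,4) by (simp add: sum_nonneg_eq_0_iff)
  then have "solvable F S 0 (\<lambda>A B. p A * q B) 0" by (intro solvable_zero) auto
  then show ?thesis using True by (auto intro: solvable_mono)
next
  case False
  define Q where "Q = sum q F"
  define r where "r = card S div s"
  have Q: "Q > 0" using False assms(4) sum_nonneg[of F q] by (simp add: Q_def less_le)
  define quit where "quit A \<longleftrightarrow> sum q {B\<in>F. A \<inter> B \<inter> S = {}} < 1 / 2 ^ t * Q" for A
  let ?X = "{A\<in>F. \<not> quit A}"
  \<comment> \<open>If Alice does not quit, her set is disjoint in \<open>S\<close> from at least a
    \<open>1 / 2 ^ t\<close> fraction of Bob's mass, which is the degree condition. \<open>Z\<close>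
    depends only on \<open>S\<close> and the weights, so both players know it.\<close>
  have "\<exists>Z\<subseteq>{B\<in>F. q B \<noteq> 0}. card Z \<le> 4 ^ t \<and>
    sum p {A\<in>?X. \<forall>z\<in>Z. A \<inter> z \<inter> S \<noteq> {}} \<le> (1 - 1 / 2 ^ t) ^ 4 ^ t * sum p ?X"
    using assms(1,3,4) Q by (intro greedy_cover) (auto simp: quit_def Q_def not_less)
  then obtain Z where Z: "Z \<subseteq> {B\<in>F. q B \<noteq> 0}" "card Z \<le> 4 ^ t"
    "sum p {A\<in>?X. \<forall>z\<in>Z. A \<inter> z \<inter> S \<noteq> {}} \<le> (1 - 1 / 2 ^ t) ^ 4 ^ t * sum p ?X" by blast
  have finZ: "finite Z" using Z(1) assms(1) by (auto intro: finite_subset)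
  define cov where "cov A \<longleftrightarrow> (\<exists>z\<in>Z. A \<inter> z \<inter> S = {})" for A
  define f where "f A = (SOME z. z \<in> Z \<and> A \<inter> z \<inter> S = {})" for A
  have f: "f A \<in> Z" "A \<inter> f A \<inter> S = {}" if "cov A" for A
    using someI_ex[of "\<lambda>z. z \<in> Z \<and> A \<inter> z \<inter> S = {}"] that by (auto simp: cov_def f_def)
  \<comment> \<open>The mass of \<open>p\<close> is split by Alice's behaviour: \<open>pQ\<close>
    quits and \<open>pG\<close> goes on; within \<open>pG\<close>, \<open>pC\<close> misses a set of
    \<open>Z\<close> in \<open>S\<close> and \<open>pU\<close> meets them all; \<open>pz z\<close>
    is the part of \<open>pC\<close> that names \<open>z\<close>.\<close>
  define pQ where "pQ A = (if quit A then p A else 0)" for A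
  define pG where "pG A = (if quit A then 0 else p A)" for A
  define pC where "pC A = (if cov A then pG A else 0)" for A
  define pU where "pU A = (if cov A then 0 else pG A)" for A
  define pz where "pz z A = (if f A = z then pC A else 0)" for z A
  have nn: "pQ A \<ge> 0" "pG A \<ge> 0" "pC A \<ge> 0" "pU A \<ge> 0" "pz z A \<ge> 0" for A z
    using assms(3) by (auto simp: pQ_def pG_def pC_def pU_def pz_def)
  have sums: "sum p F = sum pQ F + sum pG F" "sum pG F = sum pC F + sum pU F"
    unfolding sum.distrib[symmetric] pQ_def pG_def pC_def pU_def by (auto intro: sum.cong)
  have sumz: "(\<Sum>z\<in>Z. sum (pz z) F) = sum pC F"
  proof (subst sum.swap, intro sum.cong refl)
    fix A show "(\<Sum>z\<in>Z. pz z A) = pC A"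
      using f(1)[of A] finZ by (cases "cov A") (auto simp: pz_def pC_def)
  qed
  have U_le: "sum pU F \<le> sum pG F / (2 * 2 ^ t)"
  proof -
    have "sum pU F = sum p {A\<in>?X. \<forall>z\<in>Z. A \<inter> z \<inter> S \<noteq> {}}"
      using assms(1) unfolding pU_def pG_def cov_def
      by (auto simp: sum.inter_filter intro!: sum.cong)
    moreover have "sum p ?X = sum pG F"
      using assms(1) unfolding pG_def by (auto simp: sum.inter_filter intro!: sum.cong)
    moreover have "(1 - 1 / 2 ^ t) ^ 4 ^ t * sum pG F \<le> 1 / (2 * 2 ^ t) * sum pG F"
      using nn by (intro mult_right_mono one_minus_inverse_power_le sum_nonneg)
    ultimately show ?thesis using Z(3) by simp
  qed
  have 1: "solvable F S 0 (\<lambda>A B. pQ A * q B) (sum pQ F * Q * (1 / 2 ^ t))"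
  proof -
    have "(\<Sum>A\<in>F. \<Sum>B\<in>F. if A \<inter> B \<inter> S = {} then pQ A * q B else 0) =
        (\<Sum>A\<in>F. pQ A * sum q {B\<in>F. A \<inter> B \<inter> S = {}})"
      using assms(1) by (simp add: sum.inter_filter sum_distrib_left if_distrib cong: if_cong)
    also have "\<dots> \<le> (\<Sum>A\<in>F. pQ A * (1 / 2 ^ t * Q))"
    proof (intro sum_mono)
      fix A show "pQ A * sum q {B\<in>F. A \<inter> B \<inter> S = {}} \<le> pQ A * (1 / 2 ^ t * Q)"
        using assms(3)[of A] by (cases "quit A") (auto simp: pQ_def quit_def
          simp del: times_divide_eq_right intro!: mult_left_mono)
    qed
    also have "\<dots> = sum pQ F * Q * (1 / 2 ^ t)" unfolding sum_distrib_right[symmetric] by simp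
    finally show ?thesis by (rule solvable_mono[OF solvable_False le0])
  qed
  \<comment> \<open>An uncovered input leaves \<open>S\<close>, hence \<open>r\<close>, unchanged;
    its small mass pays for the lost round.\<close>
  have 2: "solvable F S c (\<lambda>A B. pU A * q B) (sum pU F * Q * (1 / 2 ^ t + K * (4 ^ t) ^ r))"
    unfolding Q_def r_def using nn assms(2,4) by (intro IH)
  have 3: "solvable F S (c + 2 * t) (\<lambda>A B. pC A * q B)
      (\<Sum>z\<in>Z. sum (pz z) F * Q * (1 / 2 ^ t + K * (4 ^ t) ^ r / 4 ^ t))"
  proof (rule solvable_select[OF finZ, where f = f])
    show "card Z \<le> 2 ^ (2 * t)" using Z(2) by (simp add: power_mult)
    fix A B assume "pC A * q B \<noteq> 0"
    then show "f A \<in> Z" using f(1) by (auto simp: pC_def split: if_splits)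
  next
    fix z assume z: "z \<in> Z"
    have zS: "s \<le> card (z \<inter> S)" using z Z(1) big by auto
    have card: "card (S - z) = card S - card (z \<inter> S)" "card (z \<inter> S) \<le> card S"
      using assms(2) by (auto simp: card_Diff_subset_Int Int_commute intro: card_mono)
    \<comment> \<open>\<open>z\<close> contains at least \<open>s\<close> points of
      \<open>S\<close>, so removing it lowers the quotient by at least one. For the same reason
      \<open>r\<close> is positive and \<open>r - 1\<close> is a true subtraction.\<close>
    have "card (S - z) div s \<le> (card S - s) div s" using zS card by (intro div_le_mono) simp
    also have "\<dots> = r - 1" unfolding r_def using zS card assms(5) by (simp add: le_div_geq)
    finally have le: "card (S - z) div s \<le> r - 1" .
    have "r \<noteq> 0" unfolding r_def using zS card assms(5) by (simp add: div_eq_0_iff)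
    then have r: "(4 ^ t) ^ r / 4 ^ t = ((4 ^ t) ^ (r - 1) :: real)" by (cases r) auto
    have "(4 ^ t :: real) ^ (card (S - z) div s) \<le> (4 ^ t) ^ (r - 1)"
      using le by (intro power_increasing) auto
    then have "sum (pz z) F * Q * (1 / 2 ^ t + K * (4 ^ t) ^ (card (S - z) div s)) \<le>
        sum (pz z) F * Q * (1 / 2 ^ t + K * (4 ^ t) ^ r / 4 ^ t)"
      unfolding times_divide_eq_right[symmetric] r
      using Q nn assms(7) by (intro mult_left_mono add_left_mono mult_nonneg_nonneg sum_nonneg) auto
    moreover have "solvable F (S - z) c (\<lambda>A B. pz z A * q B)
        (sum (pz z) F * Q * (1 / 2 ^ t + K * (4 ^ t) ^ (card (S - z) div s)))"
      unfolding Q_def using nn assms(2,4) by (intro IH) auto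
    ultimately have *: "solvable F (S - z) c (\<lambda>A B. pz z A * q B)
        (sum (pz z) F * Q * (1 / 2 ^ t + K * (4 ^ t) ^ r / 4 ^ t))"
      by (auto intro: solvable_mono)
    show "solvable F S c (\<lambda>A B. if f A = z then pC A * q B else 0)
        (sum (pz z) F * Q * (1 / 2 ^ t + K * (4 ^ t) ^ r / 4 ^ t))"
    proof (rule solvable_cong[OF *])
      fix A B assume "pz z A * q B \<noteq> 0"
      then have "A \<inter> z \<inter> S = {}" using f(2)[of A] by (auto simp: pz_def pC_def split: if_splits)
      then show "A \<inter> B \<inter> S = {} \<longleftrightarrow> A \<inter> B \<inter> (S - z) = {}" by blast
    qed (auto simp: pz_def)
  qed
  have 4: "solvable F S (Suc (c + 2 * t)) (\<lambda>A B. pG A * q B)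
     ((\<Sum>z\<in>Z. sum (pz z) F * Q * (1 / 2 ^ t + K * (4 ^ t) ^ r / 4 ^ t)) +
      sum pU F * Q * (1 / 2 ^ t + K * (4 ^ t) ^ r))"
  proof (rule solvable_Alice[where f = cov])
    show "solvable F S (c + 2 * t) (\<lambda>A B. if cov A then pG A * q B else 0)
      (\<Sum>z\<in>Z. sum (pz z) F * Q * (1 / 2 ^ t + K * (4 ^ t) ^ r / 4 ^ t))"
      by (rule solvable_cong[OF 3]) (auto simp: pC_def)
    show "solvable F S (c + 2 * t) (\<lambda>A B. if cov A then 0 else pG A * q B)
      (sum pU F * Q * (1 / 2 ^ t + K * (4 ^ t) ^ r))"
      by (rule solvable_cong[OF solvable_mono[OF 2]]) (auto simp: pU_def)
  qed
  let ?E = "sum pQ F * Q * (1 / 2 ^ t) + ((\<Sum>z\<in>Z. sum (pz z) F * Q *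
      (1 / 2 ^ t + K * (4 ^ t) ^ r / 4 ^ t)) + sum pU F * Q * (1 / 2 ^ t + K * (4 ^ t) ^ r))"
  have "solvable F S (Suc (Suc (c + 2 * t))) (\<lambda>A B. p A * q B) ?E"
  proof (rule solvable_Alice[where f = quit])
    show "solvable F S (Suc (c + 2 * t)) (\<lambda>A B. if quit A then p A * q B else 0)
        (sum pQ F * Q * (1 / 2 ^ t))"
      by (rule solvable_cong[OF solvable_mono[OF 1]]) (auto simp: pQ_def)
  qed (rule solvable_cong[OF 4], auto simp: pG_def)
  moreover have "?E \<le> sum p F * Q * (1 / 2 ^ t + K * (4 ^ t) ^ r / 2 ^ t)"
  proof -
    define W where "W = K * (4 ^ t) ^ r"
    have W: "W \<ge> 0" using assms(7) by (simp add: W_def)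
    have nnG: "sum pG F \<ge> 0" "sum pQ F \<ge> 0" "sum pU F \<ge> 0" using nn by (auto intro: sum_nonneg)
    \<comment> \<open>By \<open>t \<ge> 1\<close>, dividing by \<open>4 ^ t\<close> gains at least
      \<open>2 * 2 ^ t\<close>, so covered and uncovered inputs each use at most half of the allowed
      \<open>1 / 2 ^ t\<close>.\<close>
    have L: "(2::real) * 2 ^ t \<le> 4 ^ t"
    proof -
      have "(2::real) ^ 1 \<le> 2 ^ t" using assms(6) by (intro power_increasing) auto
      then have "(2::real) * 2 ^ t \<le> 2 ^ t * 2 ^ t" by (intro mult_right_mono) auto
      then show ?thesis by (simp flip: power_mult_distrib)
    qed
    have "sum pC F / 4 ^ t \<le> sum pG F / 4 ^ t"
      using sums nnG by (intro divide_right_mono) auto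
    also have "\<dots> \<le> sum pG F / (2 * 2 ^ t)" using nnG L by (intro divide_left_mono) auto
    finally have "sum pC F / 4 ^ t + sum pU F \<le> 2 * (sum pG F / (2 * 2 ^ t))" using U_le by linarith
    also have "\<dots> = sum pG F / 2 ^ t" by simp
    also have "\<dots> \<le> sum p F / 2 ^ t" using sums nnG by (intro divide_right_mono) auto
    finally have "Q * W * (sum pC F / 4 ^ t + sum pU F) \<le> Q * W * (sum p F / 2 ^ t)"
      using Q W by (intro mult_left_mono) auto
    moreover have "?E = sum p F * Q * (1 / 2 ^ t) + Q * W * (sum pC F / 4 ^ t + sum pU F)"
      unfolding sum_distrib_right[symmetric] sumz sums W_def[symmetric] by (simp add: algebra_simps)
    ultimately show ?thesis unfolding W_def[symmetric] by (simp add: algebra_simps)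
  qed
  ultimately show ?thesis unfolding Q_def r_def by (auto intro: solvable_mono)
qed

text \<open>\<open>T\<close> is the number of rounds left. In each, at most two bits tell whose set
  is large and \<open>2 * t + 2\<close> bits carry out the reduction; once both sets are small,
  hashing finishes. When no round is left, the answer is \<open>False\<close> and the bound is at
  least the total mass.\<close>

lemma solvable_product:
  fixes p q :: "'a set \<Rightarrow> real"
  assumes "finite F" "finite S" "\<And>A. p A \<ge> 0" "\<And>B. q B \<ge> 0" "s \<ge> 1" "t \<ge> 1"
  shows "solvable F S (T * (2 * t + 4) + 6 * (3 * s + t)) (\<lambda>A B. p A * q B)
      (sum p F * sum q F * (1 / 2 ^ t + 1 / (2 ^ t) ^ T * (4 ^ t) ^ (card S div s)))"
  using assms(2-4)
proof (induction T arbitrary: S p q)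
  case 0
  have "(\<Sum>A\<in>F. \<Sum>B\<in>F. if A \<inter> B \<inter> S = {} then p A * q B else 0) \<le> (\<Sum>A\<in>F. \<Sum>B\<in>F. p A * q B)"
    using 0 by (intro sum_mono) auto
  also have "\<dots> = sum p F * sum q F * 1" by (simp add: sum_product)
  also have "\<dots> \<le> sum p F * sum q F * (1 / 2 ^ t + 1 / (2 ^ t) ^ 0 * (4 ^ t) ^ (card S div s))"
    using 0 by (intro mult_left_mono mult_nonneg_nonneg sum_nonneg)
      (auto intro!: add_increasing one_le_power)
  finally show ?case by (rule solvable_mono[OF solvable_False le0])
next
  case (Suc T)
  let ?c = "T * (2 * t + 4) + 6 * (3 * s + t)"
  let ?e = "1 / 2 ^ t + 1 / (2 ^ t) ^ T * (4 ^ t) ^ (card S div s) / (2 ^ t :: real)"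
  let ?big = "\<lambda>A. s \<le> card (A \<inter> S)"
  define p1 where "p1 A = (if ?big A then p A else 0)" for A
  define p0 where "p0 A = (if ?big A then 0 else p A)" for A
  define q1 where "q1 A = (if ?big A then q A else 0)" for A
  define q0 where "q0 A = (if ?big A then 0 else q A)" for A
  have nn: "p1 A \<ge> 0" "p0 A \<ge> 0" "q1 A \<ge> 0" "q0 A \<ge> 0" for A
    using Suc.prems by (auto simp: p1_def p0_def q1_def q0_def)
  have sums: "sum p F = sum p1 F + sum p0 F" "sum q F = sum q1 F + sum q0 F"
    unfolding sum.distrib[symmetric] p1_def p0_def q1_def q0_def by (auto intro: sum.cong)
  have 1: "solvable F S (?c + 2 * t + 2) (\<lambda>A B. p A * q1 B) (sum p F * sum q1 F * ?e)"
    using assms(1,5,6) Suc.prems nn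
    by (intro solvable_product_round Suc.IH) (auto simp: q1_def split: if_splits)
  have "solvable F S (?c + 2 * t + 2) (\<lambda>B A. q0 B * p1 A) (sum q0 F * sum p1 F * ?e)"
    using assms(1,5,6) Suc.prems nn
    by (intro solvable_product_round Suc.IH) (auto simp: p1_def split: if_splits)
  then have 2: "solvable F S (?c + 2 * t + 2) (\<lambda>A B. p1 A * q0 B) (sum p1 F * sum q0 F * ?e)"
    unfolding mult.commute[of "q0 _"] mult.commute[of "sum q0 F"] by (rule solvable_swap)
  have 3: "solvable F S (?c + 2 * t + 2) (\<lambda>A B. p0 A * q0 B) (sum p0 F * sum q0 F * ?e)"
  proof -
    \<comment> \<open>For sets smaller than \<open>s\<close> the potential is at most
      \<open>4 ^ s * 2 ^ s = 2 ^ (3 * s)\<close>, so hashing with budget \<open>3 * s + t\<close>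
      leaves relative error at most \<open>1 / 2 ^ t\<close>.\<close>
    have "(\<Sum>A\<in>F. \<Sum>B\<in>F. if A \<inter> B \<inter> S = {}
          then p0 A * q0 B * 4 ^ card (A \<inter> S) * 2 ^ card (B \<inter> S) else 0) / 2 ^ (3 * s + t)
        \<le> (\<Sum>A\<in>F. \<Sum>B\<in>F. p0 A * q0 B * (2 ^ (3 * s))) / 2 ^ (3 * s + t)"
    proof (intro divide_right_mono sum_mono)
      fix A B
      show "(if A \<inter> B \<inter> S = {} then p0 A * q0 B * 4 ^ card (A \<inter> S) * 2 ^ card (B \<inter> S) else 0)
          \<le> p0 A * q0 B * (2 ^ (3 * s))"
      proof (cases "?big A \<or> ?big B")
        case False
        have "(4::real) ^ card (A \<inter> S) * 2 ^ card (B \<inter> S) \<le> 4 ^ s * 2 ^ s"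
          using False by (intro mult_mono power_increasing) auto
        also have "\<dots> = 2 ^ (3 * s)" by (simp add: power_mult flip: power_mult_distrib)
        finally have "p0 A * q0 B * (4 ^ card (A \<inter> S) * 2 ^ card (B \<inter> S)) \<le> p0 A * q0 B * 2 ^ (3 * s)"
          using nn by (intro mult_left_mono mult_nonneg_nonneg)
        then show ?thesis using nn by (simp add: mult.assoc)
      qed (auto simp: p0_def q0_def)
    qed simp
    also have "\<dots> = sum p0 F * sum q0 F * (1 / 2 ^ t)"
      by (simp add: sum_product power_add flip: sum_distrib_right)
    also have "\<dots> \<le> sum p0 F * sum q0 F * ?e"
      using nn by (intro mult_left_mono mult_nonneg_nonneg sum_nonneg) auto
    finally have "solvable F S (6 * (3 * s + t)) (\<lambda>A B. p0 A * q0 B) (sum p0 F * sum q0 F * ?e)"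
      using assms(1) Suc.prems nn by (intro solvable_mono[OF solvable_sparse]) auto
    then show ?thesis by (rule solvable_mono) auto
  qed
  have 4: "solvable F S (Suc (?c + 2 * t + 2)) (\<lambda>A B. p A * q0 B)
      (sum p1 F * sum q0 F * ?e + sum p0 F * sum q0 F * ?e)"
    by (rule solvable_Alice[where f = ?big, OF solvable_cong[OF 2] solvable_cong[OF 3]])
      (auto simp: p1_def p0_def)
  have "solvable F S (Suc (Suc (?c + 2 * t + 2))) (\<lambda>A B. p A * q B)
      (sum p F * sum q1 F * ?e + (sum p1 F * sum q0 F * ?e + sum p0 F * sum q0 F * ?e))"
    by (rule solvable_Bob[where g = ?big, OF solvable_cong[OF solvable_mono[OF 1]] solvable_cong[OF 4]])
      (auto simp: q1_def q0_def)
  moreover have "sum p F * sum q1 F * x + (sum p1 F * sum q0 F * x + sum p0 F * sum q0 F * x) =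
      sum p F * sum q F * x" for x
    unfolding sums by (simp add: algebra_simps)
  ultimately have "solvable F S (Suc (Suc (?c + 2 * t + 2))) (\<lambda>A B. p A * q B)
      (sum p F * sum q F * ?e)" by simp
  then show ?case by (rule solvable_mono) (auto simp: mult.commute)
qed


section \<open>From product measures to bounded mutual information\<close>

text \<open>Donsker-Varadhan: the \<mu>-mean of \<open>log 2 g\<close> is at most the divergence
  from the product \<nu> plus \<open>log 2\<close> of the \<nu>-mean of \<open>g\<close>. For
  \<open>g = 2 ^ u\<close> on \<open>E\<close> and 1 elsewhere, the latter mean is at most
  \<open>1 + 2 ^ u / 2 ^ u = 2\<close>.\<close>

lemma mutual_info_event_bound:
  fixes \<mu> :: "(nat set \<times> nat set) pmf" and u :: nat
  assumes supp: "set_pmf \<mu> \<subseteq> Pow {1..n} \<times> Pow {1..n}"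
    and E: "(\<Sum>a\<in>Pow {1..n}. \<Sum>b\<in>Pow {1..n}.
      if (a, b) \<in> E then pmf (map_pmf fst \<mu>) a * pmf (map_pmf snd \<mu>) b else 0) \<le> 1 / 2 ^ u"
  shows "u * measure_pmf.prob \<mu> E \<le> mutual_info n \<mu> + 1"
proof -
  let ?F = "Pow {1..n}"
  let ?\<Omega> = "?F \<times> ?F"
  define \<nu> where "\<nu> x = pmf (map_pmf fst \<mu>) (fst x) * pmf (map_pmf snd \<mu>) (snd x)" for x
  define g :: "nat set \<times> nat set \<Rightarrow> real" where "g x = (if x \<in> E then 2 ^ u else 1)" for x
  have \<mu>1: "(\<Sum>x\<in>?\<Omega>. pmf \<mu> x) = 1" using supp by (intro sum_pmf_eq_1) auto
  have p1: "(\<Sum>a\<in>?F. pmf (map_pmf fst \<mu>) a) = 1" "(\<Sum>a\<in>?F. pmf (map_pmf snd \<mu>) a) = 1"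
    using supp by (intro sum_pmf_eq_1; force)+
  have "(\<Sum>x\<in>?\<Omega>. \<nu> x) = (\<Sum>a\<in>?F. \<Sum>b\<in>?F. pmf (map_pmf fst \<mu>) a * pmf (map_pmf snd \<mu>) b)"
    unfolding sum.cartesian_product \<nu>_def by (intro sum.cong) auto
  also have "\<dots> = 1" unfolding sum_product[symmetric] p1 by simp
  finally have \<nu>1: "(\<Sum>x\<in>?\<Omega>. \<nu> x) = 1" .
  have \<mu>E: "measure_pmf.prob \<mu> E = (\<Sum>x\<in>?\<Omega>. if x \<in> E then pmf \<mu> x else 0)"
  proof -
    have "measure_pmf.prob \<mu> E = measure_pmf.prob \<mu> (?\<Omega> \<inter> E)"
    proof -
      have "?\<Omega> \<inter> E \<inter> set_pmf \<mu> = E \<inter> set_pmf \<mu>" using supp by auto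
      then show ?thesis by (metis measure_Int_set_pmf)
    qed
    also have "\<dots> = sum (pmf \<mu>) (?\<Omega> \<inter> E)" by (intro measure_measure_pmf_finite) auto
    finally show ?thesis by (simp add: sum.inter_restrict)
  qed
  have \<nu>g: "(\<Sum>x\<in>?\<Omega>. \<nu> x * g x) \<le> 2"
  proof -
    have "(\<Sum>x\<in>?\<Omega>. \<nu> x * g x) \<le> (\<Sum>x\<in>?\<Omega>. \<nu> x + 2 ^ u * (if x \<in> E then \<nu> x else 0))"
      by (intro sum_mono) (auto simp: g_def \<nu>_def)
    also have "\<dots> = 1 + 2 ^ u * (\<Sum>x\<in>?\<Omega>. if x \<in> E then \<nu> x else 0)"
      unfolding sum.distrib \<nu>1 sum_distrib_left ..
    also have "\<dots> \<le> 1 + 2 ^ u * (1 / 2 ^ u)"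
      using E by (intro add_left_mono mult_left_mono) (auto simp: \<nu>_def sum.cartesian_product' cong: if_cong)
    finally show ?thesis by simp
  qed
  \<comment> \<open>Gibbs' inequality against the reweighted product measure \<open>\<nu> g / 2\<close>, of total mass at most 1.\<close>
  have gibbs: "pmf \<mu> x * (log 2 (g x) - 1) + (pmf \<mu> x - \<nu> x * g x / 2) / ln 2
      \<le> pmf \<mu> x * log 2 (pmf \<mu> x / \<nu> x)" for x
  proof (cases "pmf \<mu> x = 0")
    case True
    then show ?thesis by (simp add: \<nu>_def g_def)
  next
    case False
    then have x: "pmf \<mu> x > 0" "x \<in> set_pmf \<mu>" by (auto simp: set_pmf_iff pmf_pos)
    have \<nu>: "\<nu> x > 0" unfolding \<nu>_def using x(2)
      by (intro mult_pos_pos pmf_positive) auto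
    have g: "g x > 0" by (simp add: g_def)
    let ?y = "\<nu> x * g x / (2 * pmf \<mu> x)"
    have "ln ?y \<le> ?y - 1" using x \<nu> g by (intro ln_le_minus_one) auto
    moreover have "ln ?y = ln (g x) - ln 2 - ln (pmf \<mu> x / \<nu> x)"
      using x \<nu> g by (simp add: ln_div ln_mult)
    ultimately have "ln (g x) - ln 2 + (1 - ?y) \<le> ln (pmf \<mu> x / \<nu> x)" by simp
    then have "pmf \<mu> x * (ln (g x) - ln 2 + (1 - ?y)) / ln 2 \<le> pmf \<mu> x * ln (pmf \<mu> x / \<nu> x) / ln 2"
      using x by (intro divide_right_mono mult_left_mono) auto
    moreover have "pmf \<mu> x * (ln (g x) - ln 2 + (1 - ?y)) / ln 2 =
        pmf \<mu> x * (log 2 (g x) - 1) + (pmf \<mu> x - \<nu> x * g x / 2) / ln 2"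
      using x by (simp add: log_def field_simps)
    ultimately show ?thesis by (simp add: log_def)
  qed
  have "u * measure_pmf.prob \<mu> E - 1 = (\<Sum>x\<in>?\<Omega>. pmf \<mu> x * (log 2 (g x) - 1))"
  proof -
    have "(\<Sum>x\<in>?\<Omega>. pmf \<mu> x * (log 2 (g x) - 1)) =
        (\<Sum>x\<in>?\<Omega>. u * (if x \<in> E then pmf \<mu> x else 0) - pmf \<mu> x)"
      by (intro sum.cong refl) (auto simp: g_def log_nat_power algebra_simps)
    then show ?thesis unfolding sum_subtractf \<mu>1 \<mu>E sum_distrib_left by simp
  qed
  \<comment> \<open>The added term is nonnegative: \<mu> has mass 1 and \<open>\<nu> x * g x\<close>
    sums to at most 2.\<close>
  also have "\<dots> \<le> (\<Sum>x\<in>?\<Omega>. pmf \<mu> x * (log 2 (g x) - 1)) +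
      ((\<Sum>x\<in>?\<Omega>. pmf \<mu> x) - (\<Sum>x\<in>?\<Omega>. \<nu> x * g x) / 2) / ln 2"
    using \<nu>g \<mu>1 by simp
  also have "\<dots> = (\<Sum>x\<in>?\<Omega>. pmf \<mu> x * (log 2 (g x) - 1) + (pmf \<mu> x - \<nu> x * g x / 2) / ln 2)"
    unfolding sum.distrib sum_subtractf sum_divide_distrib[symmetric] ..
  also have "\<dots> \<le> (\<Sum>x\<in>?\<Omega>. pmf \<mu> x * log 2 (pmf \<mu> x / \<nu> x))"
    by (intro sum_mono gibbs)
  also have "\<dots> = mutual_info n \<mu>" unfolding mutual_info_def \<nu>_def
    by (intro sum.cong) auto
  finally show ?thesis by simp
qed

section \<open>Communication bounds and the choice of parameters\<close>

lemma D_DISJ_le: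
  assumes "computes_DISJ \<mu> \<epsilon> P" "\<And>A B. bits_exchanged P A B \<le> c"
  shows "D_DISJ n \<mu> \<epsilon> \<le> c"
proof -
  have "D_DISJ n \<mu> \<epsilon> \<le> cost (Pow {1..n}) (Pow {1..n}) P"
    unfolding D_DISJ_def using assms(1) by (intro Least_le) blast
  also have "\<dots> \<le> c" unfolding cost_def using assms(2) by (subst Max_le_iff) auto
  finally show ?thesis .
qed

lemma bits_exchanged_send_all: "bits_exchanged (send_all i S) A B = Suc i"
  by (induction i arbitrary: S) auto

lemma D_DISJ_le_Suc:
  assumes "set_pmf \<mu> \<subseteq> Pow {1..n} \<times> Pow {1..n}" "\<epsilon> \<ge> 0"
  shows "D_DISJ n \<mu> \<epsilon> \<le> Suc n"
proof (rule D_DISJ_le)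
  have "AE x in measure_pmf \<mu>. x \<in> {(A, B). result (send_all n {}) A B = DISJ A B}"
    using assms(1) by (auto simp: AE_measure_pmf_iff result_send_all Int_absorb2 subset_iff)
  then have "measure_pmf.prob \<mu> {(A, B). result (send_all n {}) A B = DISJ A B} = 1"
    by (subst measure_pmf.prob_eq_1) auto
  with assms(2) show "computes_DISJ \<mu> \<epsilon> (send_all n {})" by (simp add: computes_DISJ_def)
qed (simp add: bits_exchanged_send_all)

text \<open>Both error terms become \<open>1 / 2 ^ (u + 1)\<close>: the first by
  \<open>t = u + 1\<close>, the second by \<open>2 * r + 1\<close> rounds with
  \<open>r = n div s\<close>, as \<open>(4 ^ t) ^ r = (2 ^ t) ^ (2 * r)\<close>. The event bound
  turns the total \<open>1 / 2 ^ u\<close> into \<mu>-error at most \<epsilon>.\<close>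

lemma D_DISJ_le_rounds:
  fixes u s :: nat and \<epsilon> :: real
  assumes supp: "set_pmf \<mu> \<subseteq> Pow {1..n} \<times> Pow {1..n}"
    and "s \<ge> 1" and "mutual_info n \<mu> + 1 \<le> u * \<epsilon>" "u \<ge> 1"
  shows "D_DISJ n \<mu> \<epsilon> \<le> (2 * (n div s) + 1) * (2 * Suc u + 4) + 6 * (3 * s + Suc u)"
proof -
  let ?F = "Pow {1..n}" and ?r = "n div s" and ?t = "Suc u"
  let ?T = "2 * ?r + 1"
  let ?p = "pmf (map_pmf fst \<mu>)" and ?q = "pmf (map_pmf snd \<mu>)"
  have p1: "sum ?p ?F = 1" "sum ?q ?F = 1"
    using supp by (intro sum_pmf_eq_1; force)+
  have "solvable ?F {1..n} (?T * (2 * ?t + 4) + 6 * (3 * s + ?t)) (\<lambda>A B. ?p A * ?q B)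
      (sum ?p ?F * sum ?q ?F * (1 / 2 ^ ?t + 1 / (2 ^ ?t) ^ ?T * (4 ^ ?t) ^ (card {1..n} div s)))"
    using assms(2) by (intro solvable_product) auto
  moreover have "1 / 2 ^ ?t + 1 / (2 ^ ?t) ^ ?T * (4 ^ ?t) ^ ?r = 1 / (2 ^ u :: real)"
  proof -
    have "(4 :: real) ^ ?t = (2 ^ ?t)\<^sup>2"
      by (simp add: power2_eq_square flip: power_mult_distrib)
    then have "(4 ^ ?t :: real) ^ ?r = (2 ^ ?t) ^ (2 * ?r)" by (simp only: power_mult)
    then show ?thesis by (simp add: power_add)
  qed
  ultimately obtain P where P: "\<And>A B. bits_exchanged P A B \<le> ?T * (2 * ?t + 4) + 6 * (3 * s + ?t)"
      "weighted_error ?F {1..n} (\<lambda>A B. ?p A * ?q B) P \<le> 1 / 2 ^ u"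
    unfolding solvable_def p1 by auto
  define E where "E = {(A, B). result P A B \<noteq> DISJ A B}"
  have "weighted_error ?F {1..n} (\<lambda>A B. ?p A * ?q B) P =
      (\<Sum>a\<in>?F. \<Sum>b\<in>?F. if (a, b) \<in> E then ?p a * ?q b else 0)"
    unfolding weighted_error_def
  proof (intro sum.cong refl)
    fix A B assume "A \<in> ?F" "B \<in> ?F"
    then have "A \<inter> B \<inter> {1..n} = A \<inter> B" by auto
    then show "(if result P A B = (A \<inter> B \<inter> {1..n} = {}) then 0 else ?p A * ?q B) =
        (if (A, B) \<in> E then ?p A * ?q B else 0)" by (simp add: E_def DISJ_def)
  qed
  then have "u * measure_pmf.prob \<mu> E \<le> mutual_info n \<mu> + 1"
    using P(2) by (intro mutual_info_event_bound[OF supp]) simp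
  also have "\<dots> \<le> u * \<epsilon>" by fact
  finally have "measure_pmf.prob \<mu> E \<le> \<epsilon>" using assms(4) by simp
  moreover have "{(A, B). result P A B = DISJ A B} = - E" by (auto simp: E_def)
  moreover have "measure_pmf.prob \<mu> (- E) = 1 - measure_pmf.prob \<mu> E"
    using measure_pmf.prob_compl[of E \<mu>] by (simp add: Compl_eq_Diff_UNIV)
  ultimately have "computes_DISJ \<mu> \<epsilon> P" unfolding computes_DISJ_def by simp
  then show ?thesis using P(1) by (rule D_DISJ_le)
qed

text \<open>For \<open>R = sqrt (n * t)\<close>, the choice of \<open>s\<close> between
  \<open>R\<close> and \<open>2 * R\<close> balances \<open>(n div s) * t \<le> R\<close> against
  \<open>s\<close>, and \<open>t \<le> R\<close> because \<open>t \<le> n\<close>. The constant is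
  \<open>12 + 6 + 36 + 6 = 60\<close>.\<close>

lemma rounds_cost_le:
  fixes n t s :: nat
  assumes "1 \<le> t" "t \<le> n" and s: "s = nat \<lceil>sqrt (n * t)\<rceil>"
  shows "real ((2 * (n div s) + 1) * (2 * t + 4) + 6 * (3 * s + t)) \<le> 60 * sqrt (n * t)"
proof -
  define R where "R = sqrt (n * t)"
  have "1 \<le> n * t" using assms by simp
  then have R1: "R \<ge> 1" unfolding R_def by (simp del: of_nat_mult)
  have R2: "R * R = n * t" by (simp add: R_def)
  have "s = nat \<lceil>R\<rceil>" using s by (simp add: R_def)
  then have sR: "R \<le> s" "s \<le> 2 * R" using R1 by linarith+
  have tR: "t \<le> R" unfolding R_def using assms(2)
    by (intro real_le_rsqrt) (simp add: power2_eq_square mult_right_mono)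
  have "(n div s) * t * R \<le> real ((n div s) * t) * s" using sR by (intro mult_left_mono) auto
  also have "\<dots> = real ((n div s) * s * t)" by simp
  also have "\<dots> \<le> n * t" unfolding of_nat_mult[symmetric]
    by (intro of_nat_mono mult_right_mono) auto
  finally have "(n div s) * t * R \<le> R * R" using R2 by simp
  then have d: "(n div s) * t \<le> R" using R1 by simp
  have "real ((2 * (n div s) + 1) * (2 * t + 4)) \<le> real ((2 * (n div s) + 1) * (6 * t))"
    using assms(1) by (intro of_nat_mono mult_left_mono) auto
  also have "\<dots> = 12 * ((n div s) * t) + 6 * t" by (simp add: algebra_simps)
  finally show ?thesis using d tR sR unfolding R_def[symmetric] by simp
qed

theorem theorem1p1:
  "\<exists>C::real. C > 0 \<and>
     (\<forall>(n::nat) (\<epsilon>::real) (k::real) (\<mu> :: (nat set \<times> nat set) pmf).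
        n \<ge> 1 \<longrightarrow> 0 < \<epsilon> \<longrightarrow> \<epsilon> < 1 / 2 \<longrightarrow> k \<ge> 0 \<longrightarrow>
        set_pmf \<mu> \<subseteq> Pow {1..n} \<times> Pow {1..n} \<longrightarrow>
        mutual_info n \<mu> \<le> k \<longrightarrow>
        real (D_DISJ n \<mu> \<epsilon>) \<le> C * sqrt (real n * (k + 1) / \<epsilon>))"
proof (intro exI[of _ 120] conjI allI impI)
  fix n :: nat and \<epsilon> k :: real and \<mu> :: "(nat set \<times> nat set) pmf"
  assume n: "n \<ge> 1" and \<epsilon>: "0 < \<epsilon>" "\<epsilon> < 1 / 2" and k: "k \<ge> 0"
    and supp: "set_pmf \<mu> \<subseteq> Pow {1..n} \<times> Pow {1..n}" and I: "mutual_info n \<mu> \<le> k"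
  define x where "x = (k + 1) / \<epsilon>"
  have x2: "x \<ge> 2" unfolding x_def using \<epsilon> k by (simp add: field_simps)
  define u where "u = nat \<lceil>x\<rceil>"
  have u: "x \<le> u" "u < x + 1" "u \<ge> 1" using x2 by (auto simp: u_def) linarith+
  \<comment> \<open>The factor 2 under the root absorbs rounding, by
    \<open>u + 1 \<le> 2 * x\<close>; taking it out doubles the constant 60.\<close>
  have "sqrt (2 * (n * x)) \<le> sqrt (2\<^sup>2 * (n * x))" using x2 by (intro real_sqrt_le_mono) auto
  also have "\<dots> = 2 * sqrt (n * x)" by (simp add: real_sqrt_mult)
  finally have two: "sqrt (2 * (n * x)) \<le> 2 * sqrt (n * x)" .
  have "D_DISJ n \<mu> \<epsilon> \<le> 60 * sqrt (2 * (n * x))"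
  proof (cases "Suc u \<le> n")
    case True
    define s where "s = nat \<lceil>sqrt (n * Suc u)\<rceil>"
    have "0 < n * Suc u" using n by simp
    then have "sqrt (n * Suc u) > 0" by (simp only: real_sqrt_gt_0_iff of_nat_0_less_iff)
    then have "s \<ge> 1" unfolding s_def by linarith
    moreover have "mutual_info n \<mu> + 1 \<le> u * \<epsilon>"
      using I u(1) \<epsilon>(1) by (simp add: x_def field_simps)
    ultimately have "real (D_DISJ n \<mu> \<epsilon>) \<le>
        real ((2 * (n div s) + 1) * (2 * Suc u + 4) + 6 * (3 * s + Suc u))"
      using D_DISJ_le_rounds[OF supp] u(3) by (intro of_nat_mono) auto
    also have "\<dots> \<le> 60 * sqrt (n * Suc u)" using True s_def by (intro rounds_cost_le) auto
    also have "\<dots> \<le> 60 * sqrt (n * (2 * x))"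
      unfolding of_nat_mult using u(2) x2 by (intro mult_left_mono real_sqrt_le_mono) auto
    finally show ?thesis by (simp add: mult_ac)
  next
    case False
    \<comment> \<open>Here \<open>n \<le> u\<close>, hence \<open>n \<le> 2 * x\<close>, and sending
      the whole set is cheap enough.\<close>
    have "real (D_DISJ n \<mu> \<epsilon>) \<le> Suc n" using D_DISJ_le_Suc[OF supp] \<epsilon> by (intro of_nat_mono) auto
    also have "\<dots> \<le> 2 * real n" using n by simp
    also have "real n \<le> sqrt (2 * (n * x))"
    proof (rule real_le_rsqrt)
      have "real n \<le> 2 * x" using False u(2) x2 by linarith
      then have "real n * n \<le> n * (2 * x)" by (intro mult_left_mono) auto
      then show "(real n)\<^sup>2 \<le> 2 * (n * x)" by (simp add: power2_eq_square mult_ac)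
    qed
    finally have "real (D_DISJ n \<mu> \<epsilon>) \<le> 2 * sqrt (2 * (n * x))" by simp
    then show ?thesis by (rule order_trans) (use x2 in simp)
  qed
  with two show "real (D_DISJ n \<mu> \<epsilon>) \<le> 120 * sqrt (real n * (k + 1) / \<epsilon>)"
    by (simp add: x_def)
qed simp

end
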